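(* Let $X$ be a nonempty set and let $\beta \in \omega_1$. The following are equivalent: (a) $Top(X) \in G_\delta^\beta$. (b) $Top(X)$ is a $G_\delta$ set in $2^{\mathcal{P}(X)}$. (c) $Top(X)$ is an $F_\sigma$ set in $2^{\mathcal{P}(X)}$. (d) $Top(X)$ (with the subspace topology) is Čech complete. (e) $X$ is finite.
   Context: $2^{\mathcal{P}(X)}$ is the set $\mathcal{P}(\mathcal{P}(X))$ of all families of subsets of $X$ with the product topology ($2=\{0,1\}$ discrete); a subbase of open sets is given by $A^+ = \{x : A \in x\}$ and $A^- = \{x : A \notin x\}$ for $A \subseteq X$. $Top(X) \subseteq 2^{\mathcal{P}(X)}$ is the set of all topologies on $X$, with the subspace topology. Define recursively the following classes of subsets of $2^{\mathcal{P}(X)}$: $G_\delta^0$ is the class of all $G_\delta$ sets; $G_{\delta\sigma}^0$ is the class of all countable unions of $G_\delta$ sets; for a successor ordinal $\beta$, $G_\delta^\beta$ is the class of all countable intersections of sets in $G_{\delta\sigma}^{\beta-1}$, and $G_{\delta\sigma}^\beta$ is the class of all countable unions of sets in $G_\delta^\beta$; for a limit ordinal $\gamma$, $G_\delta^\gamma = \bigcup_{\beta\in\gamma} G_\delta^\beta$ and $G_{\delta\sigma}^\gamma = \bigcup_{\beta\in\gamma} G_{\delta\sigma}^\beta$. *)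

theory Defs
  imports "HOL-Analysis.Analysis"
begin

section \<open>The ordinal $\omega_1$\<close>

text \<open>
  Elements of \<open>omega1\<close> play the role of the ordinals below $\omega_1$: the order is that of the
  cardinal successor of \<open>natLeq\<close>, i.e. the initial well-order of type $\omega_1$.  The lemmas
  \<open>countable_below_omega1\<close> and \<open>uncountable_omega1\<close> below characterize this order type.
\<close>

typedef omega1 = "Field (cardSuc natLeq)"
proof -
  have "Field (cardSuc natLeq) \<noteq> {}"
    using Cinfinite_cardSuc[OF natLeq_Cinfinite] by (auto simp: cinfinite_def)
  then show ?thesis by auto
qed

lemma Well_order_cardSuc_natLeq: "Well_order (cardSuc natLeq)"
  using cardSuc_Card_order[OF natLeq_Card_order] by (simp add: card_order_on_def)

instantiation omega1 :: wellorder
begin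

definition less_eq_omega1 :: "omega1 \<Rightarrow> omega1 \<Rightarrow> bool" where
  "\<alpha> \<le> \<beta> \<longleftrightarrow> (Rep_omega1 \<alpha>, Rep_omega1 \<beta>) \<in> cardSuc natLeq"

definition less_omega1 :: "omega1 \<Rightarrow> omega1 \<Rightarrow> bool" where
  "(\<alpha> :: omega1) < \<beta> \<longleftrightarrow> \<alpha> \<le> \<beta> \<and> \<alpha> \<noteq> \<beta>"

instance
proof
  let ?r = "cardSuc natLeq"
  have r: "refl_on (Field ?r) ?r" "trans ?r" "antisym ?r" "total_on (Field ?r) ?r" "wf (?r - Id)"
    using Well_order_cardSuc_natLeq by (auto simp: order_on_defs well_order_on_def)
  fix x y z :: omega1
  show refl: "x \<le> x"
    using r(1) Rep_omega1[of x] by (auto simp: less_eq_omega1_def refl_on_def)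
  show anti: "x = y" if "x \<le> y" "y \<le> x" for x y :: omega1
    using that r(3) by (auto simp: less_eq_omega1_def dest: antisymD intro: Rep_omega1_inject[THEN iffD1])
  show "x \<le> y \<Longrightarrow> y \<le> z \<Longrightarrow> x \<le> z"
    using r(2) by (auto simp: less_eq_omega1_def elim: transE)
  show "x < y \<longleftrightarrow> x \<le> y \<and> \<not> y \<le> x"
    using anti refl by (auto simp: less_omega1_def)
  show "x \<le> y \<or> y \<le> x"
    using r(4) Rep_omega1[of x] Rep_omega1[of y] refl
    by (cases "x = y") (auto simp: less_eq_omega1_def total_on_def Rep_omega1_inject)
  fix P and a :: omega1
  assume step: "\<And>x :: omega1. (\<And>y. y < x \<Longrightarrow> P y) \<Longrightarrow> P x"
  have "\<forall>x. Rep_omega1 x = s \<longrightarrow> P x" for s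
  proof (induction s rule: wf_induct_rule[OF r(5)])
    case (1 s)
    show ?case
    proof (intro allI impI)
      fix x assume x: "Rep_omega1 x = s"
      show "P x"
      proof (rule step)
        fix y assume "y < x"
        with x have "(Rep_omega1 y, s) \<in> ?r - Id"
          using Rep_omega1_inject[of y x] by (simp add: less_omega1_def less_eq_omega1_def)
        from 1[OF this] show "P y" by blast
      qed
    qed
  qed
  then show "P a" by blast
qed

end

context
  includes cardinal_syntax
begin

lemma countable_iff_ordLeq_natLeq: "countable A \<longleftrightarrow> |A| \<le>o natLeq"
proof -
  have "countable A \<longleftrightarrow> |A| \<le>o |UNIV :: nat set|"
    by (simp add: countable_def flip: card_of_ordLeq)
  then show ?thesis
    using card_of_nat ordIso_symmetric ordLeq_ordIso_trans by blast
qed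

lemma countable_below_omega1: "countable {..<\<beta> :: omega1}"
proof -
  let ?r = "cardSuc natLeq"
  have "|underS ?r (Rep_omega1 \<beta>)| <o ?r"
    by (rule card_of_underS[OF cardSuc_Card_order[OF natLeq_Card_order] Rep_omega1])
  then have "|underS ?r (Rep_omega1 \<beta>)| \<le>o natLeq"
    using cardSuc_ordLeq_ordLess[OF natLeq_Card_order card_of_Card_order] by blast
  then have "countable (underS ?r (Rep_omega1 \<beta>))"
    by (simp add: countable_iff_ordLeq_natLeq)
  moreover have "Rep_omega1 ` {..<\<beta>} \<subseteq> underS ?r (Rep_omega1 \<beta>)"
    by (auto simp: underS_def less_omega1_def less_eq_omega1_def Rep_omega1_inject)
  ultimately have "countable (Rep_omega1 ` {..<\<beta>})"
    by (rule countable_subset[rotated])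
  then show ?thesis
    by (rule countable_image_inj_on) (simp add: inj_on_def Rep_omega1_inject)
qed

lemma uncountable_omega1: "uncountable (UNIV :: omega1 set)"
proof
  assume "countable (UNIV :: omega1 set)"
  then have "countable (Field (cardSuc natLeq))"
    using countable_image[of UNIV Rep_omega1]
    unfolding type_definition.Rep_range[OF type_definition_omega1] by blast
  then have "|Field (cardSuc natLeq)| \<le>o natLeq"
    by (simp add: countable_iff_ordLeq_natLeq)
  moreover have "|Field (cardSuc natLeq)| =o cardSuc natLeq"
    by (rule card_of_Field_ordIso[OF cardSuc_Card_order[OF natLeq_Card_order]])
  ultimately have "cardSuc natLeq \<le>o natLeq"
    by (metis ordIso_ordLeq_trans ordIso_symmetric)
  then show False
    using cardSuc_greater[OF natLeq_Card_order] not_ordLeq_ordLess by blast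
qed

end

definition is_succ_of :: "omega1 \<Rightarrow> omega1 \<Rightarrow> bool" where
  "is_succ_of \<beta> \<alpha> \<longleftrightarrow> \<alpha> < \<beta> \<and> (\<forall>\<gamma>. \<alpha> < \<gamma> \<longrightarrow> \<beta> \<le> \<gamma>)"


section \<open>The classes $G_\delta^\beta$ and $G_{\delta\sigma}^\beta$\<close>

text \<open>
  The condition \<open>\<forall>\<gamma>. \<beta> \<le> \<gamma>\<close> says $\beta = 0$, and \<open>is_succ_of \<beta> \<alpha>\<close> says $\beta = \alpha + 1$; the
  remaining (\<open>else\<close>) case is that of a limit ordinal.
  Countable unions and intersections are indexed by \<open>nat\<close>.
\<close>

context
  notes conj_cong [fundef_cong]
begin

function (sequential)
  Gdelta_class :: "'b topology \<Rightarrow> omega1 \<Rightarrow> 'b set set" and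
  Gdeltasigma_class :: "'b topology \<Rightarrow> omega1 \<Rightarrow> 'b set set"
where
  "Gdelta_class T \<beta> =
     (if \<forall>\<gamma>. \<beta> \<le> \<gamma> then {S. gdelta_in T S}
      else if \<exists>\<alpha>. is_succ_of \<beta> \<alpha>
        then {S. \<exists>\<alpha> A. is_succ_of \<beta> \<alpha> \<and> S = (\<Inter>n::nat. A n) \<and> range A \<subseteq> Gdeltasigma_class T \<alpha>}
      else (\<Union>\<alpha>\<in>{..<\<beta>}. Gdelta_class T \<alpha>))"
| "Gdeltasigma_class T \<beta> =
     (if (\<forall>\<gamma>. \<beta> \<le> \<gamma>) \<or> (\<exists>\<alpha>. is_succ_of \<beta> \<alpha>)
        then {S. \<exists>A. S = (\<Union>n::nat. A n) \<and> range A \<subseteq> Gdelta_class T \<beta>}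
      else (\<Union>\<alpha>\<in>{..<\<beta>}. Gdeltasigma_class T \<alpha>))"
  by pat_completeness auto

termination
proof (relation "inv_image ({(\<alpha> :: omega1, \<beta>). \<alpha> < \<beta>} <*lex*> less_than)
          (case_sum (\<lambda>(T, \<beta>). (\<beta>, 0 :: nat)) (\<lambda>(T, \<beta>). (\<beta>, 1)))", goal_cases)
  case 1
  show ?case by (intro wf_inv_image wf_lex_prod wf wf_less_than)
qed (auto simp: is_succ_of_def)

end

declare Gdelta_class.simps [simp del] Gdeltasigma_class.simps [simp del]


section \<open>The space $2^{\mathcal{P}(X)}$ and its subspace of topologies\<close>

text \<open>
  The points of \<open>family_space X\<close> are the families of subsets of \<open>X\<close> themselves; the product
  topology is transported along the identification of a family with its characteristic function.
\<close>

definition family_space :: "'a set \<Rightarrow> 'a set set topology" where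
  "family_space X =
     pullback_topology (Pow (Pow X)) (\<lambda>x. \<lambda>A\<in>Pow X. A \<in> x)
       (product_topology (\<lambda>_. discrete_topology (UNIV :: bool set)) (Pow X))"

lemma topspace_family_space: "topspace (family_space X) = Pow (Pow X)"
  by (auto simp: family_space_def topspace_pullback_topology)

lemma family_space_eq_generated:
  "family_space X =
     topology_generated_by
       ((\<lambda>A. {x \<in> Pow (Pow X). A \<in> x}) ` Pow X \<union> (\<lambda>A. {x \<in> Pow (Pow X). A \<notin> x}) ` Pow X)"
  (is "_ = topology_generated_by ?B")
proof -
  let ?G = "topology_generated_by ?B"
  let ?P = "product_topology (\<lambda>_. discrete_topology (UNIV :: bool set)) (Pow X)"
  let ?f = "\<lambda>x. \<lambda>A\<in>Pow X. A \<in> x"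
  have topG: "topspace ?G = Pow (Pow X)"
  proof -
    have "x \<in> \<Union> ?B" if "x \<in> Pow (Pow X)" for x
    proof (cases "{} \<in> x")
      case True
      with that show ?thesis by (intro UnionI[of "{x \<in> Pow (Pow X). {} \<in> x}"] UnI1 imageI) auto
    next
      case False
      with that show ?thesis by (intro UnionI[of "{x \<in> Pow (Pow X). {} \<notin> x}"] UnI2 imageI) auto
    qed
    moreover have "\<Union> ?B \<subseteq> Pow (Pow X)" by blast
    ultimately show ?thesis unfolding topology_generated_by_topspace by blast
  qed
  have fam: "openin (family_space X) {x \<in> Pow (Pow X). (A \<in> x) = b}" if A: "A \<in> Pow X" for A b
  proof -
    have "openin ?P {g \<in> topspace ?P. g A = b}"
      using openin_continuous_map_preimage[OF continuous_map_product_projection[OF A,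
          of "\<lambda>_. discrete_topology (UNIV :: bool set)"], of "{b}"] by simp
    moreover have "{x \<in> Pow (Pow X). (A \<in> x) = b} = ?f -` {g \<in> topspace ?P. g A = b} \<inter> Pow (Pow X)"
      using A by (simp add: vimage_def Int_def conj_commute)
    ultimately show ?thesis
      unfolding family_space_def openin_pullback_topology by blast
  qed
  have 1: "openin (family_space X) U" if "U \<in> ?B" for U
    using that fam[of _ True] fam[of _ False] by (elim UnE imageE) simp_all
  have 2: "continuous_map ?G ?P ?f"
  proof (subst continuous_map_componentwise, intro conjI ballI)
    show "?f ` topspace ?G \<subseteq> extensional (Pow X)" by auto
    fix A assume A: "A \<in> Pow X"
    have "openin ?G {x \<in> topspace ?G. ?f x A \<in> V}" for V
    proof -
      have o: "openin ?G {x \<in> Pow (Pow X). A \<in> x}" "openin ?G {x \<in> Pow (Pow X). A \<notin> x}"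
        using A by (auto intro!: topology_generated_by_Basis)
      have "{x \<in> topspace ?G. ?f x A \<in> V} =
          (if True \<in> V then {x \<in> Pow (Pow X). A \<in> x} else {}) \<union>
          (if False \<in> V then {x \<in> Pow (Pow X). A \<notin> x} else {})"
        unfolding topG using A by (auto split: if_splits) (metis (full_types))+
      then show ?thesis using o by auto
    qed
    then show "continuous_map ?G (discrete_topology UNIV) (\<lambda>x. ?f x A)"
      unfolding continuous_map_def openin_discrete_topology topspace_discrete_topology by blast
  qed
  have "openin (family_space X) U \<longleftrightarrow> openin ?G U" for U
  proof
    assume "openin (family_space X) U"
    then obtain V where V: "openin ?P V" "U = ?f -` V \<inter> Pow (Pow X)"
      by (auto simp: family_space_def openin_pullback_topology)
    then show "openin ?G U"
      using openin_continuous_map_preimage[OF 2 V(1)] unfolding topG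
      by (simp add: vimage_def Int_def conj_commute)
  next
    assume "openin ?G U"
    then have "generate_topology_on ?B U" by (simp add: openin_topology_generated_by_iff)
    then show "openin (family_space X) U"
      by (induction rule: generate_topology_on.induct) (auto intro: 1)
  qed
  then show ?thesis by (simp add: topology_eq)
qed

definition Top :: "'a set \<Rightarrow> 'a set set set" where
  "Top X = {Collect (openin T) | T. topspace T = X}"

lemma Top_iff:
  "\<tau> \<in> Top X \<longleftrightarrow>
     \<tau> \<subseteq> Pow X \<and> {} \<in> \<tau> \<and> X \<in> \<tau> \<and> (\<forall>U\<in>\<tau>. \<forall>V\<in>\<tau>. U \<inter> V \<in> \<tau>) \<and> (\<forall>\<K>\<subseteq>\<tau>. \<Union>\<K> \<in> \<tau>)"
  (is "_ \<longleftrightarrow> ?R")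
proof
  assume "\<tau> \<in> Top X"
  then show ?R by (auto simp: Top_def dest: openin_subset)
next
  assume R: ?R
  then have "istopology (\<lambda>U. U \<in> \<tau>)"
    by (auto simp: istopology_def subset_iff)
  then have o: "openin (topology (\<lambda>U. U \<in> \<tau>)) = (\<lambda>U. U \<in> \<tau>)"
    by (rule topology_inverse')
  then have "topspace (topology (\<lambda>U. U \<in> \<tau>)) = X"
    using R by (auto simp: topspace_def)
  then show "\<tau> \<in> Top X"
    unfolding Top_def using o by force
qed


section \<open>\v{C}ech completeness\<close>

text \<open>
  The Stone-\v{C}ech compactification of a Tychonoff space \<open>T\<close>, realized as the closure of the image
  of \<open>T\<close> under the evaluation map into the cube $[0,1]^{C(T,[0,1])}$.  Functions on \<open>T\<close> are taken
  to be extensional, so that every continuous map contributes exactly one coordinate.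
\<close>

definition unit_interval_maps :: "'a topology \<Rightarrow> ('a \<Rightarrow> real) set" where
  "unit_interval_maps T =
     {f \<in> extensional (topspace T). continuous_map T (top_of_set {0..1}) f}"

definition stone_cech_embedding :: "'a topology \<Rightarrow> 'a \<Rightarrow> ('a \<Rightarrow> real) \<Rightarrow> real" where
  "stone_cech_embedding T x = (\<lambda>f\<in>unit_interval_maps T. f x)"

definition stone_cech :: "'a topology \<Rightarrow> (('a \<Rightarrow> real) \<Rightarrow> real) topology" where
  "stone_cech T =
     (let Q = product_topology (\<lambda>_. top_of_set {0..1}) (unit_interval_maps T)
      in subtopology Q (Q closure_of (stone_cech_embedding T ` topspace T)))"

definition cech_complete_space :: "'a topology \<Rightarrow> bool" where
  "cech_complete_space T \<longleftrightarrow>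
     completely_regular_space T \<and> Hausdorff_space T \<and>
     gdelta_in (stone_cech T) (stone_cech_embedding T ` topspace T)"

end

theory Submission
  imports Defs
begin

text \<open>
  For finite \<open>X\<close> the space of families is finite and discrete, so all five conditions hold.  For
  infinite \<open>X\<close> all of them fail, and every failure is witnessed by topologies that are chains under
  inclusion; for a chain, closure under finite intersections is automatic, and only unions matter.

  The classes $G_\delta^\beta$ cannot contain the set of topologies because membership in a set of
  such a class depends, near each of its points, on only countably many coordinates
  (\<open>countably_supported_classes\<close>).  Embed the rationals into \<open>X\<close> and take the chain \<open>\<tau>\<close> of all lower
  sets, together with \<open>X\<close>.  It has uncountably many members of the form $\{q : q < t\}$ with \<open>t\<close>
  real, so every countable set of coordinates misses one of them, and removing that one
  destroys the topology, since the cut at \<open>t\<close> is the union of the cuts at the rationals below \<open>t\<close>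
  (\<open>fragile_topology\<close>).

  The same chain defeats \v{C}ech completeness.  The damaged chain \<open>\<tau> - {L}\<close> is a limit of topologies,
  because its finite restrictions extend to finite chains.  If the
  topologies formed a $G_\delta$ set in their Stone-\v{C}ech compactification, then countably many
  continuous functions, hence countably many coordinates, would decide near \<open>\<tau>\<close> which points
  of the compactification are topologies; a compactness argument turns this into the statement that
  every limit of topologies agreeing with \<open>\<tau>\<close> on these coordinates is a topology
  (\<open>cech_complete_countable_support\<close>).

  That the set of topologies is not $F_\sigma$ comes from a continuous map from sets of natural
  numbers to families that sends exactly the infinite sets to topologies
  (\<open>prefix_family_in_Top\<close>, \<open>prefix_family_not_in_Top\<close>).  The infinite sets are not $F_\sigma$ in the
  Cantor space: starting from a finite set, one leaves the closed sets one after the other by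
  adding one large number each time (\<open>not_fsigma_Top\<close>).
\<close>

section \<open>Sets determined by countably many coordinates at each point\<close>

text \<open>
  Openness in the topology generated by the $G_\delta$ sets, for points of \<open>P\<close> with
  coordinates \<open>c x i\<close>.  The coordinate map is a parameter because the notion is needed both for
  families, whose coordinates are the truth values of \<open>A \<in> x\<close>, and for points of a cube.
\<close>

definition countably_supported :: "'p set \<Rightarrow> ('p \<Rightarrow> 'i \<Rightarrow> 'v) \<Rightarrow> 'p set \<Rightarrow> bool" where
  "countably_supported P c S \<longleftrightarrow>
     (\<forall>x\<in>S. \<exists>C. countable C \<and> (\<forall>y\<in>P. (\<forall>i\<in>C. c y i = c x i) \<longrightarrow> y \<in> S))"

lemma countably_supported_Union:
  assumes "\<And>n::nat. countably_supported P c (A n)"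
  shows "countably_supported P c (\<Union>n. A n)"
  unfolding countably_supported_def
proof
  fix x assume "x \<in> (\<Union>n. A n)"
  then obtain n where "x \<in> A n" by blast
  then obtain C where "countable C" "\<forall>y\<in>P. (\<forall>i\<in>C. c y i = c x i) \<longrightarrow> y \<in> A n"
    using assms[of n] unfolding countably_supported_def by blast
  then show "\<exists>C. countable C \<and> (\<forall>y\<in>P. (\<forall>i\<in>C. c y i = c x i) \<longrightarrow> y \<in> (\<Union>n. A n))"
    by blast
qed

lemma countably_supported_Inter:
  assumes "\<And>n::nat. countably_supported P c (A n)"
  shows "countably_supported P c (\<Inter>n. A n)"
  unfolding countably_supported_def
proof
  fix x assume x: "x \<in> (\<Inter>n. A n)"
  have "\<forall>n. \<exists>C. countable C \<and> (\<forall>y\<in>P. (\<forall>i\<in>C. c y i = c x i) \<longrightarrow> y \<in> A n)"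
    using assms x unfolding countably_supported_def by blast
  then obtain C where C: "\<And>n. countable (C n)"
      "\<And>n y. y \<in> P \<Longrightarrow> (\<forall>i\<in>C n. c y i = c x i) \<Longrightarrow> y \<in> A n"
    by metis
  have "countable (\<Union>n. C n)" using C(1) by blast
  moreover have "\<forall>y\<in>P. (\<forall>i\<in>(\<Union>n. C n). c y i = c x i) \<longrightarrow> y \<in> (\<Inter>n. A n)"
    using C(2) by blast
  ultimately show "\<exists>C. countable C \<and> (\<forall>y\<in>P. (\<forall>i\<in>C. c y i = c x i) \<longrightarrow> y \<in> (\<Inter>n. A n))"
    by blast
qed

lemma countably_supported_gdelta:
  assumes "\<And>U. openin T U \<Longrightarrow> countably_supported P c U" and "gdelta_in T S"
  shows "countably_supported P c S"
proof -
  obtain A where A: "\<And>n::nat. openin T (A n)" "\<Inter>(range A) = S"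
    using assms(2) unfolding gdelta_in_descending by blast
  have "countably_supported P c (\<Inter>n. A n)"
    by (intro countably_supported_Inter assms(1) A(1))
  then show ?thesis using A(2) by simp
qed

lemma Gdelta_class_zero: "\<forall>\<gamma>. \<beta> \<le> \<gamma> \<Longrightarrow> Gdelta_class T \<beta> = {S. gdelta_in T S}"
  by (subst Gdelta_class.simps) (rule if_P)

lemma Gdelta_class_succ:
  assumes "is_succ_of \<beta> \<alpha>"
  shows "Gdelta_class T \<beta> =
    {S. \<exists>\<alpha> A. is_succ_of \<beta> \<alpha> \<and> S = (\<Inter>n::nat. A n) \<and> range A \<subseteq> Gdeltasigma_class T \<alpha>}"
proof -
  have "\<not> (\<forall>\<gamma>. \<beta> \<le> \<gamma>)" using assms by (auto simp: is_succ_of_def not_le)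
  moreover have "\<exists>\<alpha>. is_succ_of \<beta> \<alpha>" using assms by blast
  ultimately show ?thesis
    by (subst Gdelta_class.simps) (rule trans[OF if_not_P if_P])
qed

lemma Gdelta_class_limit:
  assumes "\<not> (\<forall>\<gamma>. \<beta> \<le> \<gamma>)" "\<nexists>\<alpha>. is_succ_of \<beta> \<alpha>"
  shows "Gdelta_class T \<beta> = (\<Union>\<alpha>\<in>{..<\<beta>}. Gdelta_class T \<alpha>)"
  by (subst Gdelta_class.simps) (rule trans[OF if_not_P[OF assms(1)] if_not_P[OF assms(2)]])

lemma Gdeltasigma_class_not_limit:
  assumes "(\<forall>\<gamma>. \<beta> \<le> \<gamma>) \<or> (\<exists>\<alpha>. is_succ_of \<beta> \<alpha>)"
  shows "Gdeltasigma_class T \<beta> = {S. \<exists>A. S = (\<Union>n::nat. A n) \<and> range A \<subseteq> Gdelta_class T \<beta>}"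
  by (subst Gdeltasigma_class.simps) (rule if_P[OF assms])

lemma Gdeltasigma_class_limit:
  assumes "\<not> ((\<forall>\<gamma>. \<beta> \<le> \<gamma>) \<or> (\<exists>\<alpha>. is_succ_of \<beta> \<alpha>))"
  shows "Gdeltasigma_class T \<beta> = (\<Union>\<alpha>\<in>{..<\<beta>}. Gdeltasigma_class T \<alpha>)"
  by (subst Gdeltasigma_class.simps) (rule if_not_P[OF assms])

text \<open>
  Countable unions and countable intersections are the only operations that build the classes, and
  both preserve countable support: for an intersection, the union of countably many
  countable supports is again countable.
\<close>

lemma countably_supported_classes:
  assumes "\<And>U. openin T U \<Longrightarrow> countably_supported P c U"
  shows "(S \<in> Gdelta_class T \<beta> \<longrightarrow> countably_supported P c S) \<and>
         (S \<in> Gdeltasigma_class T \<beta> \<longrightarrow> countably_supported P c S)"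
proof (induction \<beta> arbitrary: S rule: less_induct)
  case (less \<beta>)
  have G: "countably_supported P c S" if S: "S \<in> Gdelta_class T \<beta>" for S
  proof -
    consider "\<forall>\<gamma>. \<beta> \<le> \<gamma>" | \<alpha> where "is_succ_of \<beta> \<alpha>"
      | "\<not> (\<forall>\<gamma>. \<beta> \<le> \<gamma>)" "\<nexists>\<alpha>. is_succ_of \<beta> \<alpha>" by blast
    then show ?thesis
    proof cases
      case 1
      then have "gdelta_in T S" using S Gdelta_class_zero[OF 1] by blast
      then show ?thesis by (rule countably_supported_gdelta[rotated]) (rule assms)
    next
      case 2
      with S obtain \<alpha> A where A: "is_succ_of \<beta> \<alpha>" "S = (\<Inter>n::nat. A n)"
          "range A \<subseteq> Gdeltasigma_class T \<alpha>"
        unfolding Gdelta_class_succ[OF 2] by blast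
      then have "countably_supported P c (A n)" for n
        using less[of \<alpha>] by (auto simp: is_succ_of_def)
      then show ?thesis unfolding A(2) by (rule countably_supported_Inter)
    next
      case 3
      with S obtain \<alpha> where "\<alpha> < \<beta>" "S \<in> Gdelta_class T \<alpha>"
        unfolding Gdelta_class_limit[OF 3] by blast
      then show ?thesis using less[of \<alpha> S] by blast
    qed
  qed
  have "countably_supported P c S" if S: "S \<in> Gdeltasigma_class T \<beta>" for S
  proof (cases "(\<forall>\<gamma>. \<beta> \<le> \<gamma>) \<or> (\<exists>\<alpha>. is_succ_of \<beta> \<alpha>)")
    case True
    from S obtain A where A: "S = (\<Union>n::nat. A n)" "range A \<subseteq> Gdelta_class T \<beta>"
      unfolding Gdeltasigma_class_not_limit[OF True] by blast
    then have "countably_supported P c (A n)" for n using G by blast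
    then show ?thesis unfolding A(1) by (rule countably_supported_Union)
  next
    case False
    with S obtain \<alpha> where "\<alpha> < \<beta>" "S \<in> Gdeltasigma_class T \<alpha>"
      unfolding Gdeltasigma_class_limit[OF False] by blast
    then show ?thesis using less[of \<alpha> S] by blast
  qed
  with G show ?case by blast
qed

text \<open>
  A set is the union and the intersection of the constant sequence of itself, so the hierarchy
  increases from its bottom level.
\<close>

lemma gdelta_in_classes:
  assumes "gdelta_in T S"
  shows "S \<in> Gdelta_class T \<beta> \<and> S \<in> Gdeltasigma_class T \<beta>"
proof (induction \<beta> rule: less_induct)
  case (less \<beta>)
  consider "\<forall>\<gamma>. \<beta> \<le> \<gamma>" | \<alpha> where "is_succ_of \<beta> \<alpha>"
    | "\<not> (\<forall>\<gamma>. \<beta> \<le> \<gamma>)" "\<nexists>\<alpha>. is_succ_of \<beta> \<alpha>" by blast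
  then have G: "S \<in> Gdelta_class T \<beta>"
  proof cases
    case 1
    with assms show ?thesis unfolding Gdelta_class_zero[OF 1] by blast
  next
    case 2
    with less have "S \<in> Gdeltasigma_class T \<alpha>" by (auto simp: is_succ_of_def)
    with 2 have "\<exists>\<alpha> A. is_succ_of \<beta> \<alpha> \<and> S = (\<Inter>n::nat. A n) \<and> range A \<subseteq> Gdeltasigma_class T \<alpha>"
      by (intro exI[of _ \<alpha>] exI[of _ "\<lambda>_. S"]) auto
    then show ?thesis unfolding Gdelta_class_succ[OF 2] by blast
  next
    case 3
    then obtain \<gamma> where "\<gamma> < \<beta>" by (auto simp: not_le)
    with less[of \<gamma>] show ?thesis unfolding Gdelta_class_limit[OF 3] by blast
  qed
  have "S \<in> Gdeltasigma_class T \<beta>"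
  proof (cases "(\<forall>\<gamma>. \<beta> \<le> \<gamma>) \<or> (\<exists>\<alpha>. is_succ_of \<beta> \<alpha>)")
    case True
    have "\<exists>A. S = (\<Union>n::nat. A n) \<and> range A \<subseteq> Gdelta_class T \<beta>"
      using G by (intro exI[of _ "\<lambda>_. S"]) auto
    then show ?thesis unfolding Gdeltasigma_class_not_limit[OF True] by blast
  next
    case False
    then obtain \<gamma> where "\<gamma> < \<beta>" by (auto simp: not_le)
    with less[of \<gamma>] show ?thesis unfolding Gdeltasigma_class_limit[OF False] by blast
  qed
  with G show ?case by blast
qed


section \<open>Neighbourhoods in products and in the space of families\<close>

lemma openin_product_finite_support:
  assumes "openin (product_topology T I) U" "x \<in> U"
  obtains F where "finite F" "F \<subseteq> I"
    "\<And>y. y \<in> topspace (product_topology T I) \<Longrightarrow> (\<forall>i\<in>F. y i = x i) \<Longrightarrow> y \<in> U"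
proof -
  obtain V where V: "finite {i \<in> I. V i \<noteq> topspace (T i)}" "x \<in> Pi\<^sub>E I V" "Pi\<^sub>E I V \<subseteq> U"
    using bspec[OF assms(1)[unfolded openin_product_topology_alt] assms(2)] by blast
  show thesis
  proof
    fix y assume y: "y \<in> topspace (product_topology T I)"
      "\<forall>i\<in>{i \<in> I. V i \<noteq> topspace (T i)}. y i = x i"
    have "y i \<in> V i" if "i \<in> I" for i
      using that y V(2) by (cases "V i = topspace (T i)") (auto simp: PiE_iff)
    then have "y \<in> Pi\<^sub>E I V" using y(1) by (auto simp: PiE_iff)
    then show "y \<in> U" using V(3) by blast
  qed (use V(1) in auto)
qed

lemma openin_family_space_finite_support:
  assumes "openin (family_space X) U" "x \<in> U"
  obtains F where "finite F" "F \<subseteq> Pow X"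
    "\<And>y. y \<subseteq> Pow X \<Longrightarrow> (\<forall>A\<in>F. A \<in> y \<longleftrightarrow> A \<in> x) \<Longrightarrow> y \<in> U"
proof -
  let ?P = "product_topology (\<lambda>_. discrete_topology (UNIV :: bool set)) (Pow X)"
  let ?f = "\<lambda>x. \<lambda>A\<in>Pow X. A \<in> x"
  obtain V where V: "openin ?P V" "U = ?f -` V \<inter> Pow (Pow X)"
    using assms(1) unfolding family_space_def openin_pullback_topology by blast
  then have "?f x \<in> V" using assms(2) by simp
  from openin_product_finite_support[OF V(1) this] obtain F where F: "finite F" "F \<subseteq> Pow X"
    "\<And>y. y \<in> topspace ?P \<Longrightarrow> (\<forall>i\<in>F. y i = ?f x i) \<Longrightarrow> y \<in> V" by metis
  show thesis
  proof (rule that[OF F(1,2)])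
    fix y assume y: "y \<subseteq> Pow X" "\<forall>A\<in>F. A \<in> y \<longleftrightarrow> A \<in> x"
    have "?f y \<in> V" using F(2) y(2) by (intro F(3)) auto
    then show "y \<in> U" using V(2) y(1) by simp
  qed
qed

lemma openin_family_space_subbasic:
  assumes "A \<subseteq> X"
  shows "openin (family_space X) {x \<in> Pow (Pow X). A \<in> x}"
    and "openin (family_space X) {x \<in> Pow (Pow X). A \<notin> x}"
  unfolding family_space_eq_generated using assms by (auto intro!: topology_generated_by_Basis)

lemma countably_supported_openin_family_space:
  assumes "openin (family_space X) U"
  shows "countably_supported (Pow (Pow X)) (\<lambda>x A. A \<in> x) U"
  unfolding countably_supported_def
proof
  fix x assume "x \<in> U"
  from openin_family_space_finite_support[OF assms this] obtain F where "finite F"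
    "\<And>y. y \<subseteq> Pow X \<Longrightarrow> (\<forall>A\<in>F. A \<in> y \<longleftrightarrow> A \<in> x) \<Longrightarrow> y \<in> U" by metis
  then show "\<exists>C. countable C \<and> (\<forall>y\<in>Pow (Pow X). (\<forall>A\<in>C. (A \<in> y) = (A \<in> x)) \<longrightarrow> y \<in> U)"
    by (intro exI[of _ F]) (auto simp: countable_finite)
qed

lemma topspace_subtopology_family_space:
  assumes "S \<subseteq> Pow (Pow X)"
  shows "topspace (subtopology (family_space X) S) = S"
  using assms by (auto simp: topspace_family_space)

lemma Top_subset: "Top X \<subseteq> Pow (Pow X)"
proof
  fix x assume "x \<in> Top X"
  then have "x \<subseteq> Pow X" unfolding Top_iff by (rule conjunct1)
  then show "x \<in> Pow (Pow X)" by (rule PowI)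
qed

lemma stone_cech_embedding_in_cube:
  assumes "x \<in> topspace T"
  shows "stone_cech_embedding T x \<in>
    topspace (product_topology (\<lambda>_. top_of_set {0..1}) (unit_interval_maps T))"
proof -
  have "f x \<in> {0..1}" if "f \<in> unit_interval_maps T" for f
    using that assms continuous_map_funspace[of T "top_of_set {0..1}" f]
    by (auto simp: unit_interval_maps_def)
  then show ?thesis by (auto simp: stone_cech_embedding_def)
qed

lemma families_eqI:
  assumes "x \<subseteq> Pow X" "y \<subseteq> Pow X" "\<And>A. A \<subseteq> X \<Longrightarrow> A \<in> x \<longleftrightarrow> A \<in> y"
  shows "x = y"
proof (rule set_eqI)
  fix A show "A \<in> x \<longleftrightarrow> A \<in> y"
    using assms(1,2) assms(3)[of A] by (cases "A \<subseteq> X") auto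
qed

lemma family_space_finite:
  assumes "finite X"
  shows "family_space X = discrete_topology (Pow (Pow X))"
proof -
  have "openin (family_space X) {x}" if x: "x \<in> Pow (Pow X)" for x
  proof -
    have eq: "y = x" if "y \<in> (\<Inter>A\<in>Pow X. {y \<in> Pow (Pow X). A \<in> y \<longleftrightarrow> A \<in> x})" for y
    proof -
      have "y \<subseteq> Pow X" "A \<subseteq> X \<Longrightarrow> A \<in> y \<longleftrightarrow> A \<in> x" for A using that by blast+
      with x show ?thesis by (intro families_eqI[of y X]) auto
    qed
    have "{x} = (\<Inter>A\<in>Pow X. {y \<in> Pow (Pow X). A \<in> y \<longleftrightarrow> A \<in> x})"
    proof
      show "(\<Inter>A\<in>Pow X. {y \<in> Pow (Pow X). A \<in> y \<longleftrightarrow> A \<in> x}) \<subseteq> {x}"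
        by (intro subsetI, drule eq) simp
    qed (use x in auto)
    moreover have "openin (family_space X) {y \<in> Pow (Pow X). A \<in> y \<longleftrightarrow> A \<in> x}" if "A \<in> Pow X" for A
      using openin_family_space_subbasic[of A X] that by (cases "A \<in> x") auto
    ultimately show ?thesis
      using assms by (simp only:) (rule openin_INT2, auto)
  qed
  then show ?thesis
    by (metis discrete_topology_unique topspace_family_space)
qed

text \<open>
  A finite image in a Hausdorff cube is closed, so it is its own Stone-\v{C}ech compactification.
\<close>

lemma cech_complete_finite_discrete:
  assumes "finite S"
  shows "cech_complete_space (discrete_topology S)"
proof -
  let ?T = "discrete_topology S"
  let ?Q = "product_topology (\<lambda>_. top_of_set {0..1::real}) (unit_interval_maps ?T)"
  let ?E = "stone_cech_embedding ?T ` S"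
  have "Hausdorff_space ?Q"
    by (simp add: Hausdorff_space_product_topology Hausdorff_space_subtopology)
  moreover have E: "?E \<subseteq> topspace ?Q"
    using stone_cech_embedding_in_cube[of _ ?T] by (metis image_subsetI topspace_discrete_topology)
  ultimately have "closedin ?Q ?E"
    using assms by (simp add: closedin_Hausdorff_finite)
  then have "?Q closure_of ?E = ?E" by (simp add: closure_of_closedin)
  then have "topspace (stone_cech ?T) = ?E"
    using E by (auto simp: stone_cech_def Let_def)
  then have "gdelta_in (stone_cech ?T) ?E" by (metis gdelta_in_topspace)
  then show ?thesis
    by (simp add: cech_complete_space_def completely_regular_space_discrete_topology)
qed


section \<open>Chains of sets as topologies\<close>

lemma chain_in_Top:
  assumes "\<tau> \<subseteq> Pow X" "{} \<in> \<tau>" "X \<in> \<tau>"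
    and "\<And>U V. U \<in> \<tau> \<Longrightarrow> V \<in> \<tau> \<Longrightarrow> U \<subseteq> V \<or> V \<subseteq> U"
    and "\<And>K. K \<subseteq> \<tau> \<Longrightarrow> \<Union>K \<in> \<tau>"
  shows "\<tau> \<in> Top X"
  unfolding Top_iff using assms by (metis inf.absorb1 inf.absorb2)

lemma finite_chain_in_Top:
  assumes "\<tau> \<subseteq> Pow X" "{} \<in> \<tau>" "X \<in> \<tau>" "finite \<tau>"
    and "\<And>U V. U \<in> \<tau> \<Longrightarrow> V \<in> \<tau> \<Longrightarrow> U \<subseteq> V \<or> V \<subseteq> U"
  shows "\<tau> \<in> Top X"
proof (rule chain_in_Top[OF assms(1,2,3,5)])
  fix K assume K: "K \<subseteq> \<tau>"
  show "\<Union>K \<in> \<tau>"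
  proof (cases "K = {}")
    case False
    have "\<Union>K \<in> K"
      using K False assms(4,5) by (intro Union_in_chain[of K \<tau>])
        (auto simp: subset_chain_def intro: finite_subset)
    with K show ?thesis by blast
  qed (use assms(2) in simp)
qed

lemma Union_in_if_Top: "\<tau> \<in> Top X \<Longrightarrow> K \<subseteq> \<tau> \<Longrightarrow> \<Union>K \<in> \<tau>"
  by (simp add: Top_iff)

definition rat_cut :: "real \<Rightarrow> rat set" where
  "rat_cut t = {q. of_rat q < t}"

lemma inj_rat_cut: "inj rat_cut"
proof (rule injI)
  fix s t assume "rat_cut s = rat_cut t"
  then have "\<And>q. of_rat q < s \<longleftrightarrow> of_rat q < t" by (auto simp: rat_cut_def)
  then show "s = t" by (metis linorder_neqE_linordered_idom of_rat_dense order_less_asym)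
qed

lemma Union_rat_cut: "(\<Union>r\<in>rat_cut t. rat_cut (of_rat r)) = rat_cut t"
proof
  show "rat_cut t \<subseteq> (\<Union>r\<in>rat_cut t. rat_cut (of_rat r))"
    unfolding rat_cut_def using of_rat_dense by blast
qed (auto simp: rat_cut_def intro: less_trans)

text \<open>
  Every countable set \<open>C\<close> of coordinates misses some real cut \<open>L\<close>, as there are uncountably many.
  Removing \<open>L\<close> leaves a chain that is closed under finite unions and intersections but not
  under arbitrary unions; on finitely many coordinates such a chain looks like a
  finite chain, which is a topology.  The topology \<open>\<tau>\<close> has to be chosen before \<open>C\<close>, because the
  countable set arises from a neighbourhood of \<open>\<tau>\<close>.
\<close>

lemma fragile_topology:
  assumes "infinite X"
  obtains \<tau> where "\<tau> \<in> Top X"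
    and "\<And>C. countable C \<Longrightarrow> \<exists>L. L \<notin> C \<and> \<tau> - {L} \<notin> Top X \<and>
           (\<forall>F. finite F \<longrightarrow> (\<exists>\<sigma>\<in>Top X. \<forall>A\<in>F. A \<in> \<sigma> \<longleftrightarrow> A \<in> \<tau> - {L}))"
proof -
  obtain f :: "nat \<Rightarrow> 'a" where f: "inj f" "range f \<subseteq> X"
    using assms infinite_countable_subset by blast
  define g :: "rat \<Rightarrow> 'a" where "g = f \<circ> to_nat"
  have g: "inj g" "range g \<subseteq> X"
    using f by (auto simp: g_def inj_compose)
  define lower :: "rat set \<Rightarrow> bool" where "lower A \<longleftrightarrow> (\<forall>q\<in>A. \<forall>p\<le>q. p \<in> A)" for A
  (* All lower sets rather than only the real cuts: they are visibly closed under unions. *)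
  define \<tau> where "\<tau> = insert X ((`) g ` Collect lower)"
  have lower_cut: "lower (rat_cut t)" for t
    unfolding lower_def rat_cut_def
    by (metis (mono_tags, lifting) le_less_trans mem_Collect_eq of_rat_less_eq)
  have lower_chain: "A \<subseteq> B \<or> B \<subseteq> A" if "lower A" "lower B" for A B
    using that unfolding lower_def by (meson linear subsetI)
  have sub: "\<tau> \<subseteq> Pow X" using g by (auto simp: \<tau>_def)
  have empty: "{} \<in> \<tau>"
    by (auto simp: \<tau>_def lower_def)
  have X: "X \<in> \<tau>" by (simp add: \<tau>_def)
  have chain: "U \<subseteq> V \<or> V \<subseteq> U" if "U \<in> \<tau>" "V \<in> \<tau>" for U V
  proof (cases "U = X \<or> V = X")
    case True
    with that sub show ?thesis by blast
  next
    case False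
    with that obtain A B where "lower A" "lower B" "U = g ` A" "V = g ` B"
      by (auto simp: \<tau>_def)
    then show ?thesis using lower_chain[of A B] by blast
  qed
  have union: "\<Union>K \<in> \<tau>" if K: "K \<subseteq> \<tau>" for K
  proof (cases "X \<in> K")
    case True
    with K sub have "\<Union>K = X" by blast
    with X show ?thesis by simp
  next
    case False
    then have "K \<subseteq> (`) g ` Collect lower" using K by (auto simp: \<tau>_def)
    then obtain \<A> where \<A>: "\<A> \<subseteq> Collect lower" "K = (`) g ` \<A>"
      by (meson subset_imageE)
    then have "\<Union>K = g ` \<Union>\<A>" "lower (\<Union>\<A>)"
      unfolding lower_def by blast+
    then show ?thesis by (auto simp: \<tau>_def)
  qed
  show thesis
  proof (rule that)
    show "\<tau> \<in> Top X" by (rule chain_in_Top[OF sub empty X chain union])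
  next
    fix C :: "'a set set" assume C: "countable C"
    have inj: "inj (\<lambda>t. g ` rat_cut t)"
      using inj_rat_cut g(1) by (auto simp: inj_on_def inj_image_eq_iff[OF g(1)])
    have "\<exists>t. g ` rat_cut t \<notin> C"
    proof (rule ccontr)
      assume "\<not> ?thesis"
      then have "range (\<lambda>t. g ` rat_cut t) \<subseteq> C" by blast
      with C have "countable (range (\<lambda>t. g ` rat_cut t))" by (rule countable_subset[rotated])
      then show False using countable_image_inj_on[OF _ inj] uncountable_UNIV_real by blast
    qed
    then obtain t where t: "g ` rat_cut t \<notin> C" by blast
    define L where "L = g ` rat_cut t"
    (* p and q show that the cut at t is neither empty nor all of the rationals. *)
    obtain p where p: "real_of_rat p < t"
      using of_rat_dense[of "t - 1" t] by auto
    obtain q where q: "t < real_of_rat q"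
      using of_rat_dense[of t "t + 1"] by auto
    have L_ne: "L \<noteq> {}" using p by (auto simp: L_def rat_cut_def)
    have L_X: "L \<noteq> X"
    proof
      assume "L = X"
      then have "g q \<in> g ` rat_cut t" using g(2) by (auto simp: L_def)
      with q show False using g(1) by (auto simp: rat_cut_def inj_image_mem_iff)
    qed
    have "\<tau> - {L} \<notin> Top X"
    proof
      assume T: "\<tau> - {L} \<in> Top X"
      define K where "K = (\<lambda>r. g ` rat_cut (of_rat r)) ` rat_cut t"
      have "g ` rat_cut (of_rat r) \<noteq> L" if "r \<in> rat_cut t" for r
        using that inj by (auto simp: L_def rat_cut_def dest: injD)
      then have "K \<subseteq> \<tau> - {L}"
        using lower_cut by (auto simp: K_def \<tau>_def)
      then have "\<Union>K \<in> \<tau> - {L}" by (rule Union_in_if_Top[OF T])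
      moreover have "\<Union>K = g ` (\<Union>r\<in>rat_cut t. rat_cut (of_rat r))"
        unfolding K_def by blast
      then have "\<Union>K = L" by (simp add: Union_rat_cut L_def)
      ultimately show False by simp
    qed
    moreover have "\<exists>\<sigma>\<in>Top X. \<forall>A\<in>F. A \<in> \<sigma> \<longleftrightarrow> A \<in> \<tau> - {L}" if "finite F" for F
    proof
      (* Adding the empty set and X does not disturb the agreement on F: both differ from L. *)
      let ?\<sigma> = "{{}, X} \<union> (\<tau> - {L}) \<inter> F"
      show "?\<sigma> \<in> Top X"
      proof (rule finite_chain_in_Top)
        show "?\<sigma> \<subseteq> Pow X" using sub by auto
        show "finite ?\<sigma>" using that by auto
        have "?\<sigma> \<subseteq> \<tau>" using empty X by auto
        then show "U \<subseteq> V \<or> V \<subseteq> U" if "U \<in> ?\<sigma>" "V \<in> ?\<sigma>" for U V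
          using that chain by blast
      qed auto
      show "\<forall>A\<in>F. A \<in> ?\<sigma> \<longleftrightarrow> A \<in> \<tau> - {L}"
        using empty X L_ne L_X by auto
    qed
    ultimately show "\<exists>L. L \<notin> C \<and> \<tau> - {L} \<notin> Top X \<and>
           (\<forall>F. finite F \<longrightarrow> (\<exists>\<sigma>\<in>Top X. \<forall>A\<in>F. A \<in> \<sigma> \<longleftrightarrow> A \<in> \<tau> - {L}))"
      using t L_def by blast
  qed
qed

lemma not_countably_supported_Top:
  assumes "infinite X"
  shows "\<not> countably_supported (Pow (Pow X)) (\<lambda>x A. A \<in> x) (Top X)"
proof
  assume S: "countably_supported (Pow (Pow X)) (\<lambda>x A. A \<in> x) (Top X)"
  obtain \<tau> where \<tau>: "\<tau> \<in> Top X"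
    "\<And>C. countable C \<Longrightarrow> \<exists>L. L \<notin> C \<and> \<tau> - {L} \<notin> Top X"
    using fragile_topology[OF assms] by metis
  from bspec[OF S[unfolded countably_supported_def] \<tau>(1)]
  obtain C where C: "countable C"
    "\<forall>y\<in>Pow (Pow X). (\<forall>A\<in>C. (A \<in> y) = (A \<in> \<tau>)) \<longrightarrow> y \<in> Top X" by (elim exE conjE)
  obtain L where L: "L \<notin> C" "\<tau> - {L} \<notin> Top X" using \<tau>(2)[OF C(1)] by blast
  have "\<tau> - {L} \<in> Top X"
    using L(1) \<tau>(1) Top_subset[of X] by (intro C(2)[rule_format]) auto
  with L show False by blast
qed


section \<open>Failure of \v{C}ech completeness\<close>

text \<open>
  Membership of a point of the Stone-\v{C}ech compactification in the $G_\delta$ image of \<open>S\<close> depends, near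
  the image of \<open>\<tau>\<close>, on countably many functions; by continuity each value of such a function at \<open>\<tau>\<close> is
  determined up to \<open>1 / (n + 1)\<close> by finitely many coordinates of \<open>\<tau>\<close>.  Let \<open>C\<close> collect all these
  coordinates.  If \<open>y\<close> is a limit of \<open>S\<close> that agrees with \<open>\<tau>\<close> on \<open>C\<close>, then a cluster point \<open>z\<close>, in the
  compactification, of the elements of \<open>S\<close> approaching \<open>y\<close> has the same values as \<open>\<tau>\<close> at these
  functions, so \<open>z\<close> is the image of some \<open>\<rho> \<in> S\<close>.  The functions that test \<open>A \<in> \<sigma>\<close> are continuous
  and extend to \<open>z\<close>, which forces \<open>\<rho> = y\<close>.
\<close>

lemma cech_complete_countable_support:
  assumes S: "S \<subseteq> Pow (Pow X)"
    and cech: "cech_complete_space (subtopology (family_space X) S)"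
    and \<tau>: "\<tau> \<in> S"
  obtains C where "countable C"
    "\<And>y. y \<subseteq> Pow X \<Longrightarrow> (\<forall>A\<in>C. A \<in> y \<longleftrightarrow> A \<in> \<tau>) \<Longrightarrow>
       \<forall>F. finite F \<longrightarrow> (\<exists>\<sigma>\<in>S. \<forall>A\<in>F. A \<in> \<sigma> \<longleftrightarrow> A \<in> y) \<Longrightarrow> y \<in> S"
proof -
  define T where "T = subtopology (family_space X) S"
  define I where "I = unit_interval_maps T"
  define Q where "Q = product_topology (\<lambda>_. top_of_set {0..1::real}) I"
  define e where "e = stone_cech_embedding T"
  have topT: "topspace T = S"
    unfolding T_def by (rule topspace_subtopology_family_space[OF S])
  have e: "e x f = f x" if "f \<in> I" for x f
    using that by (simp add: e_def stone_cech_embedding_def I_def)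
  have eQ: "e ` S \<subseteq> topspace Q"
    using stone_cech_embedding_in_cube[of _ T] by (auto simp: e_def Q_def I_def topT simp del: topspace_product_topology)
  have scT: "stone_cech T = subtopology Q (Q closure_of (e ` S))"
    by (simp add: stone_cech_def Let_def Q_def I_def e_def topT)
  have gd: "gdelta_in (subtopology Q (Q closure_of (e ` S))) (e ` S)"
    using cech unfolding cech_complete_space_def T_def[symmetric] scT topT e_def[symmetric] by blast
  have op: "countably_supported (Q closure_of (e ` S)) (\<lambda>z f. z f) U"
    if U: "openin (subtopology Q (Q closure_of (e ` S))) U" for U
    unfolding countably_supported_def
  proof
    fix z assume z: "z \<in> U"
    obtain V where V: "openin Q V" "U = V \<inter> Q closure_of (e ` S)"
      using U by (auto simp: openin_subtopology)
    with z have "z \<in> V" by simp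
    from openin_product_finite_support[OF V(1)[unfolded Q_def] this] obtain F where
      F: "finite F" "\<And>y. y \<in> topspace Q \<Longrightarrow> (\<forall>i\<in>F. y i = z i) \<Longrightarrow> y \<in> V"
      unfolding Q_def by metis
    then show "\<exists>C. countable C \<and> (\<forall>y\<in>Q closure_of (e ` S). (\<forall>i\<in>C. y i = z i) \<longrightarrow> y \<in> U)"
      using V(2) closure_of_subset_topspace[of Q "e ` S"]
      by (intro exI[of _ F]) (auto simp: countable_finite)
  qed
  have "countably_supported (Q closure_of (e ` S)) (\<lambda>z f. z f) (e ` S)"
    by (rule countably_supported_gdelta[OF _ gd]) (rule op)
  from bspec[OF this[unfolded countably_supported_def] imageI[OF \<tau>]]
  obtain K where K: "countable K"
    "\<forall>z\<in>Q closure_of (e ` S). (\<forall>f\<in>K. z f = e \<tau> f) \<longrightarrow> z \<in> e ` S"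
    by (elim exE conjE)
  have "\<exists>F. finite F \<and> (\<forall>\<sigma>\<in>S. (\<forall>A\<in>F. A \<in> \<sigma> \<longleftrightarrow> A \<in> \<tau>) \<longrightarrow> \<bar>f \<sigma> - f \<tau>\<bar> < 1 / real (Suc n))"
    if f: "f \<in> I" for f n
  proof -
    let ?B = "ball (f \<tau>) (1 / real (Suc n))"
    have "continuous_map T euclideanreal f"
      using f unfolding I_def unit_interval_maps_def
      by (auto simp: continuous_map_in_subtopology)
    then have "openin T {\<sigma> \<in> topspace T. f \<sigma> \<in> ?B}"
      by (rule openin_continuous_map_preimage) simp
    then obtain U where U: "openin (family_space X) U" "{\<sigma> \<in> S. f \<sigma> \<in> ?B} = U \<inter> S"
      unfolding topT by (auto simp: T_def openin_subtopology)
    have "\<tau> \<in> {\<sigma> \<in> S. f \<sigma> \<in> ?B}" using \<tau> by simp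
    then have "\<tau> \<in> U" using U(2) by blast
    from openin_family_space_finite_support[OF U(1) this] obtain F where F: "finite F"
      "\<And>y. y \<subseteq> Pow X \<Longrightarrow> (\<forall>A\<in>F. A \<in> y \<longleftrightarrow> A \<in> \<tau>) \<Longrightarrow> y \<in> U" by metis
    have "\<bar>f \<sigma> - f \<tau>\<bar> < 1 / real (Suc n)" if "\<sigma> \<in> S" "\<forall>A\<in>F. A \<in> \<sigma> \<longleftrightarrow> A \<in> \<tau>" for \<sigma>
    proof -
      have "\<sigma> \<in> U" using that S by (intro F(2)) auto
      then have "f \<sigma> \<in> ?B" using U(2) that by blast
      then show ?thesis by (simp add: dist_real_def abs_minus_commute)
    qed
    with F(1) show ?thesis by blast
  qed
  then obtain N where N: "\<And>f n. f \<in> I \<Longrightarrow> finite (N f n)"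
    "\<And>f n \<sigma>. f \<in> I \<Longrightarrow> \<sigma> \<in> S \<Longrightarrow> (\<forall>A\<in>N f n. A \<in> \<sigma> \<longleftrightarrow> A \<in> \<tau>) \<Longrightarrow> \<bar>f \<sigma> - f \<tau>\<bar> < 1 / real (Suc n)"
    by metis
  define C where "C = (\<Union>f\<in>K \<inter> I. \<Union>n. N f n)"
  show thesis
  proof
    show "countable C"
      unfolding C_def
      by (intro countable_UN countable_Int1 K(1)) (auto intro: countable_finite N(1))
  next
    fix y assume y: "y \<subseteq> Pow X" and yC: "\<forall>A\<in>C. A \<in> y \<longleftrightarrow> A \<in> \<tau>"
      and lim: "\<forall>F. finite F \<longrightarrow> (\<exists>\<sigma>\<in>S. \<forall>A\<in>F. A \<in> \<sigma> \<longleftrightarrow> A \<in> y)"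
    (* A point z common to all Z F is a cluster point of the elements of S as they approach y. *)
    define Z where "Z F = Q closure_of (e ` {\<sigma> \<in> S. \<forall>A\<in>F. A \<in> \<sigma> \<longleftrightarrow> A \<in> y})" for F
    have Z_mono: "Z G \<subseteq> Z F" if "F \<subseteq> G" for F G
      unfolding Z_def using that by (intro closure_of_mono) auto
    have Z_ne: "Z F \<noteq> {}" if F: "finite F" for F
    proof -
      obtain \<sigma> where \<sigma>: "\<sigma> \<in> S" "\<forall>A\<in>F. A \<in> \<sigma> \<longleftrightarrow> A \<in> y" using lim F by blast
      then have "e \<sigma> \<in> e ` {\<sigma> \<in> S. \<forall>A\<in>F. A \<in> \<sigma> \<longleftrightarrow> A \<in> y}" by blast
      moreover have "\<dots> \<subseteq> Z F"
        unfolding Z_def using eQ by (intro closure_of_subset) auto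
      ultimately show ?thesis by blast
    qed
    have "compact_space Q"
      unfolding Q_def compact_space_product_topology
      by (simp add: compact_space_subtopology compactin_euclidean_iff)
    have "\<exists>z. \<forall>F. finite F \<longrightarrow> z \<in> Z F"
    proof -
      have "\<Inter>\<G> \<noteq> {}" if \<G>: "finite \<G>" "\<G> \<subseteq> Z ` Collect finite" for \<G>
      proof -
        obtain \<F> where \<F>: "finite \<F>" "\<F> \<subseteq> Collect finite" "\<G> = Z ` \<F>"
          using \<G> finite_subset_image by metis
        then have "finite (\<Union>\<F>)" by auto
        moreover have "Z (\<Union>\<F>) \<subseteq> \<Inter>\<G>"
          unfolding \<F>(3) by (intro INT_greatest Z_mono) auto
        ultimately show ?thesis using Z_ne by blast
      qed
      moreover have "\<forall>W\<in>Z ` Collect finite. closedin Q W" by (auto simp: Z_def)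
      ultimately have "\<Inter>(Z ` Collect finite) \<noteq> {}"
        using \<open>compact_space Q\<close>[unfolded compact_space_fip, rule_format, of "Z ` Collect finite"]
        by simp
      then show ?thesis by blast
    qed
    then obtain z where z: "\<And>F. finite F \<Longrightarrow> z \<in> Z F" by blast
    have zQ: "z \<in> topspace Q"
      using subsetD[OF closure_of_subset_topspace z[of "{}", unfolded Z_def]] by simp
    (* A closed condition that f satisfies on all elements of S close to y passes to the
       coordinate of z at f. *)
    have z_in: "z f \<in> R" if "f \<in> I" "finite F" "closed R"
        "\<And>\<sigma>. \<sigma> \<in> S \<Longrightarrow> (\<forall>A\<in>F. A \<in> \<sigma> \<longleftrightarrow> A \<in> y) \<Longrightarrow> f \<sigma> \<in> R" for f F R
    proof -
      have "continuous_map Q (top_of_set {0..1::real}) (\<lambda>z. z f)"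
        unfolding Q_def by (rule continuous_map_product_projection[OF that(1)])
      then have "continuous_map Q euclideanreal (\<lambda>z. z f)"
        by (simp add: continuous_map_in_subtopology)
      then have cl: "closedin Q {z \<in> topspace Q. z f \<in> R}"
        by (rule closedin_continuous_map_preimage) (simp add: that(3))
      have "Z F \<subseteq> {z \<in> topspace Q. z f \<in> R}"
        unfolding Z_def using that(4) e[OF that(1)] eQ by (intro closure_of_minimal[OF _ cl]) auto
      with z[OF that(2)] show ?thesis by blast
    qed
    have "z f = e \<tau> f" if f: "f \<in> K" for f
    proof (cases "f \<in> I")
      case True
      have "\<bar>z f - f \<tau>\<bar> \<le> 1 / real (Suc n)" for n
      proof -
        have "z f \<in> cball (f \<tau>) (1 / real (Suc n))"
        proof (rule z_in[OF True N(1)[OF True, of n]])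
          fix \<sigma> assume \<sigma>: "\<sigma> \<in> S" "\<forall>A\<in>N f n. A \<in> \<sigma> \<longleftrightarrow> A \<in> y"
          have "\<forall>A\<in>N f n. A \<in> \<sigma> \<longleftrightarrow> A \<in> \<tau>"
            using \<sigma>(2) yC f True unfolding C_def by blast
          from N(2)[OF True \<sigma>(1) this] show "f \<sigma> \<in> cball (f \<tau>) (1 / real (Suc n))"
            by (simp add: dist_real_def abs_minus_commute)
        qed simp
        then show ?thesis by (simp add: dist_real_def abs_minus_commute)
      qed
      then have "\<bar>z f - f \<tau>\<bar> \<le> 0"
        by (metis nat_approx_posE not_le order_le_less_trans less_irrefl)
      then show ?thesis using e[OF True] by simp
    next
      case False
      (* Outside I both points take the default value of extensional functions. *)
      then show ?thesis
        using zQ eQ \<tau> by (auto simp: Q_def PiE_iff extensional_def e_def stone_cech_embedding_def I_def)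
    qed
    moreover have "z \<in> Q closure_of (e ` S)"
      using z[of "{}"] by (simp add: Z_def)
    ultimately obtain \<rho> where \<rho>: "\<rho> \<in> S" "z = e \<rho>" using K(2) by blast
    have "A \<in> \<rho> \<longleftrightarrow> A \<in> y" if A: "A \<in> Pow X" for A
    proof -
      define h where "h = (\<lambda>\<sigma>\<in>S. if A \<in> \<sigma> then 1 else 0 :: real)"
      have "openin T {\<sigma> \<in> S. h \<sigma> \<in> V}" for V
      proof -
        let ?W = "(if 1 \<in> V then {x \<in> Pow (Pow X). A \<in> x} else {}) \<union>
                  (if 0 \<in> V then {x \<in> Pow (Pow X). A \<notin> x} else {})"
        have "openin (family_space X) ?W"
          using openin_family_space_subbasic[of A X] A by auto
        moreover have "{\<sigma> \<in> S. h \<sigma> \<in> V} = ?W \<inter> S"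
          using S by (auto simp: h_def)
        ultimately show ?thesis unfolding T_def openin_subtopology by blast
      qed
      then have "continuous_map T (top_of_set {0..1}) h"
        by (auto simp: continuous_map_def topT h_def continuous_map_in_subtopology)
      then have h: "h \<in> I" by (simp add: I_def unit_interval_maps_def topT h_def)
      have "z h \<in> {if A \<in> y then 1 else 0}"
        by (rule z_in[OF h, of "{A}"]) (auto simp: h_def)
      moreover have "z h = (if A \<in> \<rho> then 1 else 0)"
        using \<rho> e[OF h] by (simp add: h_def)
      ultimately show ?thesis by (auto split: if_splits)
    qed
    moreover have "\<rho> \<subseteq> Pow X" using S \<rho>(1) by blast
    ultimately have "\<rho> = y" using y by (intro families_eqI[of _ X]) auto
    with \<rho> show "y \<in> S" by simp
  qed
qed

lemma not_cech_complete_Top: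
  assumes "infinite X"
  shows "\<not> cech_complete_space (subtopology (family_space X) (Top X))"
proof
  assume cech: "cech_complete_space (subtopology (family_space X) (Top X))"
  obtain \<tau> where \<tau>: "\<tau> \<in> Top X"
    "\<And>C. countable C \<Longrightarrow> \<exists>L. L \<notin> C \<and> \<tau> - {L} \<notin> Top X \<and>
        (\<forall>F. finite F \<longrightarrow> (\<exists>\<sigma>\<in>Top X. \<forall>A\<in>F. A \<in> \<sigma> \<longleftrightarrow> A \<in> \<tau> - {L}))"
    using fragile_topology[OF assms] by blast
  obtain C where C: "countable C"
    "\<And>y. y \<subseteq> Pow X \<Longrightarrow> (\<forall>A\<in>C. A \<in> y \<longleftrightarrow> A \<in> \<tau>) \<Longrightarrow>
       \<forall>F. finite F \<longrightarrow> (\<exists>\<sigma>\<in>Top X. \<forall>A\<in>F. A \<in> \<sigma> \<longleftrightarrow> A \<in> y) \<Longrightarrow> y \<in> Top X"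
    by (rule cech_complete_countable_support[OF Top_subset cech \<tau>(1)]) (rule that)
  obtain L where L: "L \<notin> C" "\<tau> - {L} \<notin> Top X"
    "\<forall>F. finite F \<longrightarrow> (\<exists>\<sigma>\<in>Top X. \<forall>A\<in>F. A \<in> \<sigma> \<longleftrightarrow> A \<in> \<tau> - {L})" using \<tau>(2)[OF C(1)] by blast
  have "\<tau> - {L} \<in> Top X"
    using L(1) \<tau>(1) Top_subset[of X] by (intro C(2) L(3)) auto
  with L show False by blast
qed


section \<open>Failure of being $F_\sigma$\<close>

text \<open>
  The even numbers in \<open>tagged_prefix s m\<close> encode \<open>m\<close>, so that a single set belongs to the chain of \<open>s\<close>
  at no more than one place; the odd ones grow beyond all bounds with \<open>m\<close> exactly if \<open>s\<close> is infinite.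
  Only the part of \<open>s\<close> below \<open>m\<close> matters, which makes the resulting family depend
  continuously on \<open>s\<close>.
\<close>

definition tagged_prefix :: "nat set \<Rightarrow> nat \<Rightarrow> nat set" where
  "tagged_prefix s m = {2 * j | j. j < m} \<union> {n. odd n \<and> (\<exists>k\<in>s. n \<le> k \<and> k < m)}"

definition prefix_family :: "'a set \<Rightarrow> (nat \<Rightarrow> 'a) \<Rightarrow> nat set \<Rightarrow> 'a set set" where
  "prefix_family X g s = {{}, X, range g} \<union> range (\<lambda>m. g ` tagged_prefix s m)"

lemma double_in_tagged_prefix: "2 * j \<in> tagged_prefix s m \<longleftrightarrow> j < m"
  by (auto simp: tagged_prefix_def)

lemma tagged_prefix_mono: "m \<le> m' \<Longrightarrow> tagged_prefix s m \<subseteq> tagged_prefix s m'"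
  by (fastforce simp: tagged_prefix_def)

lemma tagged_prefix_eqD: "tagged_prefix s m = tagged_prefix s' m' \<Longrightarrow> m = m'"
  by (metis double_in_tagged_prefix linorder_neqE_nat less_irrefl)

lemma tagged_prefix_cong:
  assumes "s \<inter> {..<m} = s' \<inter> {..<m}"
  shows "tagged_prefix s m = tagged_prefix s' m"
proof -
  have "k \<in> s \<longleftrightarrow> k \<in> s'" if "k < m" for k using assms that by blast
  then show ?thesis unfolding tagged_prefix_def by blast
qed

lemma Union_tagged_prefix:
  assumes "infinite s" "infinite M"
  shows "(\<Union>m\<in>M. tagged_prefix s m) = UNIV"
proof -
  have "n \<in> (\<Union>m\<in>M. tagged_prefix s m)" for n
  proof -
    obtain k where k: "k \<in> s" "n < k" using assms(1) by (meson infinite_nat_iff_unbounded)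
    obtain m where m: "m \<in> M" "k < m" using assms(2) by (meson infinite_nat_iff_unbounded)
    have "n \<in> tagged_prefix s m"
    proof (cases "even n")
      case True
      then obtain j where "n = 2 * j" by blast
      then show ?thesis using k m double_in_tagged_prefix[of j s m] by simp
    next
      case False
      then show ?thesis using k m by (auto simp: tagged_prefix_def intro!: bexI[of _ k])
    qed
    then show ?thesis using m by blast
  qed
  then show ?thesis by blast
qed

lemma prefix_family_bound: "W \<in> prefix_family X g s \<Longrightarrow> W = X \<or> W \<subseteq> range g"
  unfolding prefix_family_def by blast

text \<open>
  The only union that could leave the chain is that of infinitely many prefixes; for infinite \<open>s\<close> it
  is all of \<open>range g\<close>, which is a member.
\<close>

lemma prefix_family_in_Top:
  assumes g: "range g \<subseteq> X" and s: "infinite s"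
  shows "prefix_family X g s \<in> Top X"
proof (rule chain_in_Top)
  fix U V assume UV: "U \<in> prefix_family X g s" "V \<in> prefix_family X g s"
  consider "U \<in> {{}, X, range g}" | "V \<in> {{}, X, range g}"
    | m m' where "U = g ` tagged_prefix s m" "V = g ` tagged_prefix s m'"
    using UV unfolding prefix_family_def by blast
  then show "U \<subseteq> V \<or> V \<subseteq> U"
  proof cases
    case 1
    with g prefix_family_bound[OF UV(2)] show ?thesis by auto
  next
    case 2
    with g prefix_family_bound[OF UV(1)] show ?thesis by auto
  next
    case 3
    then show ?thesis by (metis image_mono linear tagged_prefix_mono)
  qed
next
  fix K assume K: "K \<subseteq> prefix_family X g s"
  have KX: "\<Union>K \<subseteq> X" using K g by (auto simp: prefix_family_def)
  define M where "M = {m. g ` tagged_prefix s m \<in> K}"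
  consider "X \<in> K" | "X \<notin> K" "range g \<in> K" | "X \<notin> K" "range g \<notin> K" by blast
  then show "\<Union>K \<in> prefix_family X g s"
  proof cases
    case 1
    with KX have "\<Union>K = X" by blast
    then show ?thesis by (simp add: prefix_family_def)
  next
    case 2
    have "W \<subseteq> range g" if "W \<in> K" for W
      using that 2 K prefix_family_bound[of W X g s] by blast
    with 2 have "\<Union>K = range g" by blast
    then show ?thesis by (simp add: prefix_family_def)
  next
    case 3
    have "W = {} \<or> (\<exists>m\<in>M. W = g ` tagged_prefix s m)" if "W \<in> K" for W
      using that subsetD[OF K that] 3 unfolding prefix_family_def M_def by blast
    then have "\<Union>K \<subseteq> (\<Union>m\<in>M. g ` tagged_prefix s m)" by blast
    moreover have "(\<Union>m\<in>M. g ` tagged_prefix s m) \<subseteq> \<Union>K" unfolding M_def by blast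
    ultimately have "\<Union>K = (\<Union>m\<in>M. g ` tagged_prefix s m)" by (rule subset_antisym)
    then have UK: "\<Union>K = g ` (\<Union>m\<in>M. tagged_prefix s m)" by (simp only: image_UN)
    consider "M = {}" | "M \<noteq> {}" "finite M" | "infinite M" by blast
    then show ?thesis
    proof cases
      case 1
      then show ?thesis using UK by (simp add: prefix_family_def)
    next
      case 2
      have "tagged_prefix s m \<subseteq> tagged_prefix s (Max M)" if "m \<in> M" for m
        using 2 that by (intro tagged_prefix_mono Max_ge)
      moreover have "Max M \<in> M" using 2 by (intro Max_in)
      ultimately have "(\<Union>m\<in>M. tagged_prefix s m) = tagged_prefix s (Max M)" by blast
      then show ?thesis using UK by (simp add: prefix_family_def)
    next
      case 3
      then show ?thesis using UK Union_tagged_prefix[OF s 3] by (simp add: prefix_family_def)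
    qed
  qed
qed (use g in \<open>auto simp: prefix_family_def\<close>)

text \<open>
  The union of all prefixes contains every even number, so it is not a prefix, but it misses the
  odd numbers beyond \<open>s\<close>.
\<close>

lemma prefix_family_not_in_Top:
  assumes g: "inj g" "range g \<subseteq> X" and s: "finite s"
  shows "prefix_family X g s \<notin> Top X"
proof
  assume T: "prefix_family X g s \<in> Top X"
  let ?W = "\<Union>m. tagged_prefix s m"
  have "\<Union>(range (\<lambda>m. g ` tagged_prefix s m)) \<in> prefix_family X g s"
    by (rule Union_in_if_Top[OF T]) (auto simp: prefix_family_def)
  moreover have "\<Union>(range (\<lambda>m. g ` tagged_prefix s m)) = g ` ?W" by (simp only: image_UN)
  ultimately have W: "g ` ?W \<in> prefix_family X g s" by simp
  obtain N where N: "s \<subseteq> {..<N}" using s finite_nat_iff_bounded by blast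
  have "2 * N + 1 \<noteq> 2 * j" for j by presburger
  then have "2 * N + 1 \<notin> ?W" using N by (auto simp: tagged_prefix_def)
  then have "g (2 * N + 1) \<notin> g ` ?W" using g(1) by (simp only: inj_image_mem_iff not_False_eq_True)
  then have "g ` ?W \<noteq> X" "g ` ?W \<noteq> range g" using g(2) by blast+
  moreover have "2 * m \<in> ?W" for m using double_in_tagged_prefix[of m s "Suc m"] by auto
  then have "?W \<noteq> tagged_prefix s m" for m
    using double_in_tagged_prefix[of m s m] by blast
  then have "g ` ?W \<noteq> g ` tagged_prefix s m" for m using g(1) by (simp add: inj_image_eq_iff)
  moreover have "0 \<in> ?W" using double_in_tagged_prefix[of 0 s 1] by auto
  then have "g ` ?W \<noteq> {}" by blast
  ultimately show False using W by (auto simp: prefix_family_def)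
qed

text \<open>
  This is continuity of the map from sets of numbers to families: a given set \<open>A\<close> can occur
  only as a prefix of one definite length \<open>l\<close>, and whether it does depends on the part of \<open>s\<close> below \<open>l\<close>.
\<close>

lemma prefix_family_local:
  assumes g: "inj g" and F: "finite F"
  shows "\<exists>k. \<forall>s s'. s \<inter> {..<k} = s' \<inter> {..<k} \<longrightarrow>
           (\<forall>A\<in>F. A \<in> prefix_family X g s \<longleftrightarrow> A \<in> prefix_family X g s')"
  using F
proof (induction F rule: finite_induct)
  case (insert A F)
  then obtain k where k: "\<And>s s'. s \<inter> {..<k} = s' \<inter> {..<k} \<Longrightarrow>
    \<forall>A\<in>F. A \<in> prefix_family X g s \<longleftrightarrow> A \<in> prefix_family X g s'" by blast
  obtain l where l: "\<And>s s'. s \<inter> {..<l} = s' \<inter> {..<l} \<Longrightarrow>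
    A \<in> prefix_family X g s \<Longrightarrow> A \<in> prefix_family X g s'"
  proof (cases "\<exists>s m. A = g ` tagged_prefix s m")
    case True
    then obtain s0 l where A: "A = g ` tagged_prefix s0 l" by blast
    have "m = l" if "A = g ` tagged_prefix s m" for s m
      using that tagged_prefix_eqD unfolding A by (metis inj_image_eq_iff[OF g])
    then have "A \<in> prefix_family X g s'"
      if "s \<inter> {..<l} = s' \<inter> {..<l}" "A \<in> prefix_family X g s" for s s'
      using that tagged_prefix_cong[OF that(1)] by (auto simp: prefix_family_def)
    with that show thesis by blast
  next
    case False
    then show thesis by (intro that[of 0]) (auto simp: prefix_family_def)
  qed
  show ?case
  proof (intro exI allI impI)
    fix s s' :: "nat set" assume eq: "s \<inter> {..<max k l} = s' \<inter> {..<max k l}"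
    have "s \<inter> {..<i} = s' \<inter> {..<i}" if "i \<le> max k l" for i
      using eq that by (metis Int_assoc inf.absorb_iff2 lessThan_subset_iff)
    then have "s \<inter> {..<k} = s' \<inter> {..<k}" "s \<inter> {..<l} = s' \<inter> {..<l}" by auto
    then show "\<forall>A\<in>insert A F. A \<in> prefix_family X g s \<longleftrightarrow> A \<in> prefix_family X g s'"
      using k l by (metis insert_iff)
  qed
qed simp

text \<open>
  A Baire category argument done by hand.  A finite \<open>s\<close> yields a family that is no topology, hence
  lies outside the \<open>n\<close>-th closed set, and this is decided by \<open>s\<close> below some bound \<open>k\<close>.  Adding \<open>k\<close> itself to
  \<open>s\<close> keeps the decision and makes progress towards an infinite set.  The union \<open>t\<close> of all stages is
  infinite, so it yields a topology, yet that topology avoids every closed set.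
\<close>

lemma not_fsigma_Top:
  assumes "infinite X"
  shows "\<not> fsigma_in (family_space X) (Top X)"
proof
  assume "fsigma_in (family_space X) (Top X)"
  then obtain D where D: "\<And>n::nat. closedin (family_space X) (D n)" "\<Union>(range D) = Top X"
    unfolding fsigma_in_ascending by blast
  obtain g :: "nat \<Rightarrow> 'a" where g: "inj g" "range g \<subseteq> X"
    using assms infinite_countable_subset by blast
  let ?\<phi> = "prefix_family X g"
  have \<phi>: "?\<phi> s \<subseteq> Pow X" for s using g by (auto simp: prefix_family_def)
  have step: "\<exists>k. s \<subseteq> {..<k} \<and> (\<forall>s'. s' \<inter> {..<k} = s \<longrightarrow> ?\<phi> s' \<notin> D n)" if s: "finite s" for s n
  proof -
    have "?\<phi> s \<in> topspace (family_space X) - D n"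
      using prefix_family_not_in_Top[OF g s] D(2) \<phi> by (auto simp: topspace_family_space)
    moreover have "openin (family_space X) (topspace (family_space X) - D n)" using D(1) by blast
    ultimately obtain F where F: "finite F"
      "\<And>y. y \<subseteq> Pow X \<Longrightarrow> (\<forall>A\<in>F. A \<in> y \<longleftrightarrow> A \<in> ?\<phi> s) \<Longrightarrow> y \<in> topspace (family_space X) - D n"
      using openin_family_space_finite_support by metis
    obtain k where k: "\<And>s s'. s \<inter> {..<k} = s' \<inter> {..<k} \<Longrightarrow> \<forall>A\<in>F. A \<in> ?\<phi> s \<longleftrightarrow> A \<in> ?\<phi> s'"
      using prefix_family_local[OF g(1) F(1)] by blast
    obtain N where N: "s \<subseteq> {..<N}" using s finite_nat_iff_bounded by blast
    have "?\<phi> s' \<notin> D n" if "s' \<inter> {..<max k N} = s" for s'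
    proof -
      have "s' \<inter> {..<k} = s \<inter> {..<k}" using that by auto
      then show ?thesis using F(2)[OF \<phi>, of s'] k by blast
    qed
    moreover have "s \<subseteq> {..<max k N}" using N by auto
    ultimately show ?thesis by blast
  qed
  define \<kappa> where
    "\<kappa> n s = (SOME k. s \<subseteq> {..<k} \<and> (\<forall>s'. s' \<inter> {..<k} = s \<longrightarrow> ?\<phi> s' \<notin> D n))" for n s
  have \<kappa>: "s \<subseteq> {..<\<kappa> n s}" "s' \<inter> {..<\<kappa> n s} = s \<Longrightarrow> ?\<phi> s' \<notin> D n" if "finite s" for s n s'
    using someI_ex[OF step[OF that, of n]] unfolding \<kappa>_def by blast+
  (* By the choice of the bound, no set that extends s n only by numbers from the bound on
     has its family in D n; the later stages add only such numbers. *)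
  define s where "s = rec_nat {} (\<lambda>n s. insert (\<kappa> n s) s)"
  have s_Suc: "s (Suc n) = insert (\<kappa> n (s n)) (s n)" for n by (simp add: s_def)
  have fin: "finite (s n)" for n by (induction n) (simp_all add: s_def)
  define k where "k n = \<kappa> n (s n)" for n
  have k_mono: "strict_mono k"
    using \<kappa>(1)[OF fin] s_Suc by (force simp: strict_mono_Suc_iff k_def)
  have stable: "s (n + i) \<inter> {..<k n} = s n" for n i
  proof (induction i)
    case 0
    then show ?case using \<kappa>(1)[OF fin, of n n] by (auto simp: k_def)
  next
    case (Suc i)
    have "k n \<le> k (n + i)" using k_mono by (simp add: strict_mono_less_eq)
    with Suc show ?case by (auto simp: s_Suc k_def)
  qed
  have s_le: "s i \<subseteq> s j" if "i \<le> j" for i j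
    using that by (rule lift_Suc_mono_le[rotated]) (auto simp: s_Suc)
  define t where "t = (\<Union>n. s n)"
  have "t \<inter> {..<k n} = s n" for n
  proof
    show "t \<inter> {..<k n} \<subseteq> s n"
    proof
      fix j assume "j \<in> t \<inter> {..<k n}"
      then obtain i where "j \<in> s i" "j < k n" by (auto simp: t_def)
      moreover have "s i \<subseteq> s (n + i)" by (rule s_le) simp
      ultimately show "j \<in> s n" using stable[of n i] by blast
    qed
    show "s n \<subseteq> t \<inter> {..<k n}" using \<kappa>(1)[OF fin, of n n] by (auto simp: t_def k_def)
  qed
  then have "?\<phi> t \<notin> D n" for n
    using \<kappa>(2)[OF fin, of t n n] by (simp add: k_def)
  moreover have "range k \<subseteq> t" using s_Suc by (force simp: t_def k_def)
  then have "infinite t"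
    using k_mono finite_subset range_inj_infinite strict_mono_imp_inj_on by blast
  then have "?\<phi> t \<in> Top X" by (rule prefix_family_in_Top[OF g(2)])
  ultimately show False using D(2) by blast
qed


section \<open>The characterization\<close>

theorem corollary4p6:
  fixes X :: "'a set" and \<beta> :: omega1
  assumes "X \<noteq> {}"
  shows "(Top X \<in> Gdelta_class (family_space X) \<beta> \<longleftrightarrow> gdelta_in (family_space X) (Top X)) \<and>
         (gdelta_in (family_space X) (Top X) \<longleftrightarrow> fsigma_in (family_space X) (Top X)) \<and>
         (fsigma_in (family_space X) (Top X) \<longleftrightarrow>
            cech_complete_space (subtopology (family_space X) (Top X))) \<and>
         (cech_complete_space (subtopology (family_space X) (Top X)) \<longleftrightarrow> finite X)"
proof (cases "finite X")
  case True
  have *: "family_space X = discrete_topology (Pow (Pow X))" by (rule family_space_finite[OF True])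
  have g: "gdelta_in (family_space X) (Top X)" and f: "fsigma_in (family_space X) (Top X)"
    unfolding * by (simp_all add: open_imp_gdelta_in closed_imp_fsigma_in Top_subset)
  have "finite (Top X)" using Top_subset True by (metis finite_Pow_iff finite_subset)
  moreover have "subtopology (family_space X) (Top X) = discrete_topology (Top X)"
    unfolding * using Top_subset[of X] by (simp add: subtopology_discrete_topology Int_absorb1)
  ultimately have "cech_complete_space (subtopology (family_space X) (Top X))"
    by (simp add: cech_complete_finite_discrete)
  with g f True gdelta_in_classes[OF g] show ?thesis by blast
next
  case False
  have "Top X \<notin> Gdelta_class (family_space X) \<beta>"
    using not_countably_supported_Top[OF False] countably_supported_classes
      countably_supported_openin_family_space by blast
  moreover from this have "\<not> gdelta_in (family_space X) (Top X)"
    using gdelta_in_classes by blast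
  ultimately show ?thesis
    using False not_fsigma_Top[OF False] not_cech_complete_Top[OF False] by blast
qed

end
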